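(* For any positive integers $\alpha,m,n,r$, we have $$\sum_{k=0}^{n-1}[k(k+1)]^r\,[2k+1]\,q^{(n-1-k)(\alpha m+1)}\,w_k^{(\alpha)}(x;q)^m\equiv 0\pmod{[n]},$$ where the congruence is in the ring $\mathbb{Z}[q,q^{-1}][x]$.
   Context: Here $q$ and $x$ are indeterminates. For an integer $N$, $[N]=\frac{1-q^N}{1-q}$ is the $q$-integer, an element of $\mathbb{Z}[q,q^{-1}]$; in particular $[k(k+1)]$ is the $q$-integer of the number $k(k+1)$. For nonnegative integers $N$ and integers $k$, $\left[\begin{matrix} N \\ k \end{matrix}\right]=\frac{\prod_{1\le j\le k}[N-j+1]}{\prod_{1\le j\le k}[j]}$ is the $q$-binomial coefficient, equal to $1$ if $k=0$ and to $0$ if $k<0$ or $k>N$. For a nonnegative integer $k$ and a positive integer $\alpha$, $$w_k^{(\alpha)}(x;q)=\sum_{j=1}^{k}q^{\alpha\left(\binom{j+1}{2}-(k+1)(j-1)\right)}\left(\left[\begin{matrix} k-1 \\ j-1 \end{matrix}\right]\left[\begin{matrix} k+j \\ j \end{matrix}\right]-\left[\begin{matrix} k \\ j \end{matrix}\right]\left[\begin{matrix} k+j \\ j-1 \end{matrix}\right]\right)^{\alpha}x^{j-1}\in\mathbb{Z}[q,q^{-1}][x],$$ with $w_0^{(\alpha)}(x;q)=0$ (empty sum). A congruence $A\equiv 0\pmod{P(q)}$ means that $P(q)$ divides $A$ in $\mathbb{Z}[q,q^{-1}][x]$. *)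

theory Defs
  imports "HOL-Library.Poly_Mapping" "HOL-Computational_Algebra.Polynomial"
begin

text \<open>
  The Laurent polynomial ring \<open>\<int>[q,q\<^sup>-\<^sup>1]\<close> is the group ring of the additive group of integers:
  a finitely supported map sends an exponent of \<open>q\<close> to its coefficient, and the
  multiplication of \<^typ>\<open>int \<Rightarrow>\<^sub>0 int\<close> is convolution.  The ring \<open>\<int>[q,q\<^sup>-\<^sup>1][x]\<close> is then
  \<open>laurent poly\<close>.
\<close>

type_synonym laurent = "int \<Rightarrow>\<^sub>0 int"

definition qpow :: "int \<Rightarrow> laurent"
  where "qpow e = Poly_Mapping.single e 1"

text \<open>
  Exact quotient in the integral domain \<open>\<int>[q,q\<^sup>-\<^sup>1]\<close>, meaningful only if the divisor is nonzero and
  divides the dividend; this is shown below for every quotient that is used.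
\<close>

definition quot :: "laurent \<Rightarrow> laurent \<Rightarrow> laurent"
  where "quot a b = (THE c. b * c = a)"

definition qint :: "int \<Rightarrow> laurent"
  where "qint N = quot (1 - qpow N) (1 - qpow 1)"

definition qbinom :: "nat \<Rightarrow> int \<Rightarrow> laurent"
  where "qbinom N k =
    (if k < 0 \<or> k > int N then 0
     else quot (\<Prod>j\<in>{1..k}. qint (int N - j + 1)) (\<Prod>j\<in>{1..k}. qint j))"

definition w :: "nat \<Rightarrow> nat \<Rightarrow> laurent poly"
  where "w \<alpha> k =
    (\<Sum>j=1..k. monom
       (qpow (int \<alpha> * (int ((j + 1) choose 2) - (int k + 1) * (int j - 1))) *
        (qbinom (k - 1) (int j - 1) * qbinom (k + j) (int j)
         - qbinom k (int j) * qbinom (k + j) (int j - 1)) ^ \<alpha>)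
       (j - 1))"

lemma quot_eq:
  assumes "b \<noteq> 0" "b * c = a"
  shows "quot a b = c"
  unfolding quot_def using assms by (intro the_equality) auto

lemma mult_quot:
  assumes "b \<noteq> 0" "b dvd a"
  shows "b * quot a b = a"
  using assms quot_eq by (metis dvdE)

lemma qpow_0 [simp]: "qpow 0 = 1"
  by (simp add: qpow_def)

lemma qpow_add: "qpow (a + b) = qpow a * qpow b"
  by (simp add: qpow_def mult_single)

lemma qpow_eq_iff [simp]: "qpow a = qpow b \<longleftrightarrow> a = b"
  unfolding qpow_def by (metis lookup_single_eq lookup_single_not_eq zero_neq_one)

lemma one_minus_qpow_nonzero: "N \<noteq> 0 \<Longrightarrow> 1 - qpow N \<noteq> 0"
  using qpow_eq_iff[of 0 N] by simp

lemma one_minus_qpow_dvd: "1 - qpow 1 dvd 1 - qpow N"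
proof -
  have nat: "1 - qpow 1 dvd 1 - qpow (int n)" for n
  proof (induction n)
    case 0
    show ?case by simp
  next
    case (Suc n)
    have "1 - qpow (int (Suc n)) = (1 - qpow 1) + qpow 1 * (1 - qpow (int n))"
      using qpow_add[of 1 "int n"] by (simp add: algebra_simps)
    then show ?case using Suc by (metis dvd_add dvd_mult dvd_refl)
  qed
  show ?thesis
  proof (cases "N \<ge> 0")
    case True
    then show ?thesis using nat[of "nat N"] by simp
  next
    case False
    have "1 - qpow N = - (qpow N * (1 - qpow (- N)))"
      using qpow_add[of N "- N"] by (simp add: algebra_simps)
    then show ?thesis using nat[of "nat (- N)"] False by simp
  qed
qed

lemma qint_mult: "(1 - qpow 1) * qint N = 1 - qpow N"
  unfolding qint_def by (intro mult_quot one_minus_qpow_nonzero one_minus_qpow_dvd) simp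

lemma qint_0 [simp]: "qint 0 = 0"
  using qint_mult[of 0] one_minus_qpow_nonzero[of 1] by simp

lemma qint_nonzero: "N \<noteq> 0 \<Longrightarrow> qint N \<noteq> 0"
  using qint_mult[of N] one_minus_qpow_nonzero[of N] by auto

lemma qint_add: "qint (a + b) = qint a + qpow a * qint b"
proof -
  have "(1 - qpow 1) * qint (a + b) = (1 - qpow 1) * qint a + qpow a * ((1 - qpow 1) * qint b)"
    unfolding qint_mult by (simp add: qpow_add algebra_simps)
  also have "\<dots> = (1 - qpow 1) * (qint a + qpow a * qint b)"
    by (simp add: algebra_simps)
  finally show ?thesis
    using one_minus_qpow_nonzero[of 1] by (metis mult_left_cancel zero_neq_one)
qed

lemma prod_int_atLeastAtMost:
  fixes f :: "int \<Rightarrow> laurent"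
  shows "(\<Prod>j\<in>{1..int k}. f j) = (\<Prod>i<k. f (int i + 1))"
  by (rule prod.reindex_bij_witness[of _ "\<lambda>i. int i + 1" "\<lambda>j. nat (j - 1)"]) auto

lemma qbinom_denominator_nonzero: "(\<Prod>j\<in>{1..k}. qint j) \<noteq> 0"
  by (auto simp: qint_nonzero)

lemma qbinom_dvd: "(\<Prod>j\<in>{1..k}. qint j) dvd (\<Prod>j\<in>{1..k}. qint (int N - j + 1))"
proof (cases "k \<ge> 0")
  case False
  then show ?thesis by simp
next
  case True
  have "(\<Prod>i<m. qint (int i + 1)) dvd (\<Prod>i<m. qint (int N - int i))" for m
  proof (induction N arbitrary: m)
    case 0
    show ?case by (cases m) (simp_all add: prod.lessThan_Suc_shift del: prod.lessThan_Suc)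
  next
    case (Suc N)
    show ?case
    proof (cases m)
      case 0
      then show ?thesis by simp
    next
      case (Suc l)
      let ?D = "\<lambda>m. \<Prod>i<m. qint (int i + 1)"
      let ?P = "\<lambda>m. \<Prod>i<m. qint (int N - int i)"
      have "(\<Prod>i<m. qint (int (Suc N) - int i)) = qint (int N + 1) * ?P l"
        using Suc by (simp add: prod.lessThan_Suc_shift add.commute del: prod.lessThan_Suc)
      also have "qint (int N + 1) = qint (int l + 1) + qpow (int l + 1) * qint (int N - int l)"
        using qint_add[of "int l + 1" "int N - int l"] by (simp add: add.commute)
      finally have "(\<Prod>i<m. qint (int (Suc N) - int i))
          = ?P l * qint (int l + 1) + qpow (int l + 1) * ?P (Suc l)"
        by (simp add: algebra_simps)
      moreover have "?D m dvd ?P l * qint (int l + 1)"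
        using Suc.IH[of l] Suc by (simp add: mult_dvd_mono)
      moreover have "?D m dvd ?P (Suc l)"
        using Suc.IH[of "Suc l"] Suc by simp
      ultimately show ?thesis
        by (metis dvd_add dvd_mult)
    qed
  qed
  from this[of "nat k"] show ?thesis
    using True prod_int_atLeastAtMost[of qint "nat k"]
      prod_int_atLeastAtMost[of "\<lambda>j. qint (int N - j + 1)" "nat k"]
    by simp
qed

lemma qbinom_mult:
  assumes "0 \<le> k"
  shows "(\<Prod>j\<in>{1..k}. qint j) * qbinom N k = (\<Prod>j\<in>{1..k}. qint (int N - j + 1))"
proof (cases "k > int N")
  case True
  then have "\<exists>j\<in>{1..k}. qint (int N - j + 1) = 0"
    by (intro bexI[of _ "int N + 1"]) auto
  then show ?thesis
    using True by (simp add: qbinom_def)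
next
  case False
  then show ?thesis
    using assms mult_quot[OF qbinom_denominator_nonzero qbinom_dvd] by (simp add: qbinom_def)
qed

end

theory Submission
  imports Defs
begin

text \<open>
  A Laurent polynomial is divisible by \<open>[n]\<close> iff it vanishes at every \<open>n\<close>-th root of unity
  \<open>z \<noteq> 1\<close>.  Let \<open>d\<close> be the order of \<open>z\<close>, so \<open>d\<close> divides \<open>n\<close>, and cut \<open>{0..<n}\<close> into blocks of length \<open>d\<close>.
  At \<open>q = z\<close> the terms \<open>k = ad + b\<close> and \<open>k' = ad + (d-1-b)\<close> cancel: \<open>[k(k+1)]\<close> is symmetric and
  \<open>q\<^sup>-\<^sup>k[2k+1]\<close> antisymmetric under this reflection, and \<open>q\<close> to the power \<open>-\<alpha>k\<close> times \<open>w\<^sub>k\<close> is symmetric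
  when \<open>0 < b < d-1\<close>, by the q-Lucas theorem and the closed form of the coefficients of \<open>w\<^sub>k\<close>.
  For \<open>b = 0\<close> and \<open>b = d-1\<close> that symmetry fails, but there \<open>[k(k+1)] = 0\<close>; this is where
  \<open>r > 0\<close> enters.
\<close>

section \<open>Evaluation of Laurent polynomials\<close>

lemma laurent_induct [case_names zero add]:
  fixes f :: laurent
  assumes "P 0" "\<And>e c f. P f \<Longrightarrow> P (Poly_Mapping.single e c + f)"
  shows "P f"
proof (induction f rule: update_induct)
  case const
  show ?case by (rule assms(1))
next
  case (update f a b)
  have "Poly_Mapping.update a b f = Poly_Mapping.single a b + f"
    using update(1) by (intro poly_mapping_eqI)
      (auto simp: lookup_update lookup_add lookup_single when_def in_keys_iff)
  then show ?case using assms(2)[OF update(3)] by simp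
qed

text \<open>Evaluation at \<open>q = z\<close>. At \<open>z = 0\<close> it is not multiplicative,
  because negative powers of 0 are 0; hence the condition in \<open>ev_mult\<close>.\<close>

definition ev :: "complex \<Rightarrow> laurent \<Rightarrow> complex"
  where "ev z f = (\<Sum>e\<in>Poly_Mapping.keys f. of_int (Poly_Mapping.lookup f e) * z powi e)"

lemma ev_superset:
  assumes "finite A" "Poly_Mapping.keys f \<subseteq> A"
  shows "ev z f = (\<Sum>e\<in>A. of_int (Poly_Mapping.lookup f e) * z powi e)"
  unfolding ev_def using assms
  by (intro sum.mono_neutral_left) (auto simp: in_keys_iff)

lemma ev_0 [simp]: "ev z 0 = 0"
  by (simp add: ev_def)

lemma ev_single: "ev z (Poly_Mapping.single e c) = of_int c * z powi e"
  by (simp add: ev_def)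

lemma ev_qpow [simp]: "ev z (qpow e) = z powi e"
  by (simp add: qpow_def ev_single)

lemma ev_1 [simp]: "ev z 1 = 1"
  using ev_qpow[of z 0] by (simp del: ev_qpow)

lemma ev_add [simp]: "ev z (f + g) = ev z f + ev z g"
proof -
  let ?A = "Poly_Mapping.keys f \<union> Poly_Mapping.keys g"
  have "Poly_Mapping.keys (f + g) \<subseteq> ?A" by (rule keys_add)
  then show ?thesis
    by (simp add: ev_superset[of ?A] lookup_add algebra_simps sum.distrib)
qed

lemma ev_uminus [simp]: "ev z (- f) = - ev z f"
  using ev_add[of z "- f" f] by (simp add: add_eq_0_iff2 del: ev_add)

lemma ev_diff [simp]: "ev z (f - g) = ev z f - ev z g"
  using ev_add[of z f "- g"] by simp

lemma ev_sum [simp]: "ev z (sum f A) = (\<Sum>a\<in>A. ev z (f a))"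
  by (induction A rule: infinite_finite_induct) simp_all

lemma ev_mult [simp]:
  assumes "z \<noteq> 0"
  shows "ev z (f * g) = ev z f * ev z g"
proof (induction f rule: laurent_induct)
  case (add e c f)
  have "ev z (Poly_Mapping.single e c * g) = ev z (Poly_Mapping.single e c) * ev z g"
  proof (induction g rule: laurent_induct)
    case (add e' c' g)
    then show ?case
      using assms by (simp add: distrib_left mult_single ev_single power_int_add)
  qed simp
  with add show ?case by (simp add: distrib_right)
qed simp

lemma ev_power [simp]: "z \<noteq> 0 \<Longrightarrow> ev z (f ^ n) = ev z f ^ n"
  by (induction n) simp_all

lemma ev_prod [simp]: "z \<noteq> 0 \<Longrightarrow> ev z (prod f A) = (\<Prod>a\<in>A. ev z (f a))"
  by (induction A rule: infinite_finite_induct) simp_all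

definition evp :: "complex \<Rightarrow> laurent poly \<Rightarrow> complex poly"
  where "evp z = map_poly (ev z)"

lemma coeff_evp [simp]: "coeff (evp z p) i = ev z (coeff p i)"
  by (simp add: evp_def coeff_map_poly)

lemma evp_1 [simp]: "evp z 1 = 1"
  by (simp add: evp_def)

lemma evp_const [simp]: "evp z [:c:] = [:ev z c:]"
  by (simp add: poly_eq_iff coeff_pCons split: nat.splits)

lemma evp_sum [simp]: "evp z (sum f A) = (\<Sum>a\<in>A. evp z (f a))"
  by (simp add: poly_eq_iff coeff_sum)

lemma evp_mult [simp]: "z \<noteq> 0 \<Longrightarrow> evp z (p * q) = evp z p * evp z q"
  by (simp add: poly_eq_iff coeff_mult)

lemma evp_power [simp]: "z \<noteq> 0 \<Longrightarrow> evp z (p ^ n) = evp z p ^ n"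
  by (induction n) simp_all

section \<open>Divisibility by a q-integer\<close>

lemma qint_1 [simp]: "qint 1 = 1"
  using qint_mult[of 1] one_minus_qpow_nonzero[of 1] by simp

lemma qint_int: "qint (int n) = (\<Sum>i<n. qpow (int i))"
proof (induction n)
  case (Suc n)
  then show ?case using qint_add[of "int n" 1] by (simp add: add.commute)
qed simp

text \<open>Since \<open>[n]\<close> divides \<open>1 - q^n\<close>, exponents of \<open>q\<close>
  matter only modulo \<open>n\<close>.\<close>

lemma qint_dvd_qpow_mod: "qint (int n) dvd qpow e - qpow (e mod int n)"
proof -
  have *: "qint (int n) dvd 1 - qpow (int n * k)" for k
  proof -
    have nat: "qint (int n) dvd 1 - qpow (int n * int l)" for l
    proof (induction l)
      case (Suc l)
      have "1 - qpow (int n * int (Suc l))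
          = (1 - qpow (int n)) + qpow (int n) * (1 - qpow (int n * int l))"
        using qpow_add[of "int n" "int n * int l"] by (simp add: algebra_simps)
      then show ?case using Suc qint_mult[of "int n"] by (metis dvd_add dvd_mult dvd_triv_right)
    qed simp
    show ?thesis
    proof (cases "k \<ge> 0")
      case True
      then show ?thesis using nat[of "nat k"] by simp
    next
      case False
      have "1 - qpow (int n * k) = - (qpow (int n * k) * (1 - qpow (int n * (- k))))"
        using qpow_add[of "int n * k" "int n * (- k)"] by (simp add: algebra_simps)
      then show ?thesis using nat[of "nat (- k)"] False by simp
    qed
  qed
  have "qpow e - qpow (e mod int n) = - (qpow (e mod int n) * (1 - qpow (int n * (e div int n))))"
    using qpow_add[of "e mod int n" "int n * (e div int n)"] by (simp add: algebra_simps)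
  with * show ?thesis by simp
qed

text \<open>Division with remainder by \<open>[n]\<close>, monic of degree \<open>n - 1\<close>,
  keeping integer coefficients: exponents are first reduced modulo \<open>n\<close>, then
  \<open>q^(n-1)\<close> is eliminated.\<close>

lemma qint_remainder:
  assumes "n > 0"
  shows "\<exists>a. qint (int n) dvd f - (\<Sum>i<n - 1. Poly_Mapping.single (int i) (a i :: int))"
proof (induction f rule: laurent_induct)
  case zero
  show ?case by (intro exI[of _ "\<lambda>_. 0"]) simp
next
  case (add e c f)
  obtain a where a: "qint (int n) dvd f - (\<Sum>i<n - 1. Poly_Mapping.single (int i) (a i))"
    using add by blast
  have single: "Poly_Mapping.single k c = of_int c * qpow k" for k c
    using single_of_int[of c, where ?'b = int and ?'a = int] mult_single[of 0 c k 1]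
    by (simp add: qpow_def)
  obtain r where r: "r < n" "int r = e mod int n"
    using assms by (intro that[of "nat (e mod int n)"]) (auto simp: nat_less_iff)
  have "\<exists>b. qint (int n) dvd qpow (int r) - (\<Sum>i<n - 1. Poly_Mapping.single (int i) (b i))"
  proof (cases "r < n - 1")
    case True
    have "(\<Sum>i<n - 1. Poly_Mapping.single (int i) (if i = r then 1 else 0))
        = (\<Sum>i<n - 1. if i = r then qpow (int r) else 0)"
      by (intro sum.cong) (auto simp: qpow_def)
    then have "(\<Sum>i<n - 1. Poly_Mapping.single (int i) (if i = r then 1 else 0)) = qpow (int r)"
      using True by simp
    then show ?thesis by (intro exI[of _ "\<lambda>i. if i = r then 1 else 0"]) simp
  next
    case False
    then have n: "n = Suc r" using r by simp
    \<comment> \<open>Modulo \<open>[n]\<close>, the one power left over, \<open>q^(n-1)\<close>,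
      equals \<open>-(1 + ... + q^(n-2))\<close>.\<close>
    have "qpow (int r) - (\<Sum>i<n - 1. Poly_Mapping.single (int i) (-1)) = (\<Sum>i<n. qpow (int i))"
      by (simp add: n single sum_negf)
    then show ?thesis unfolding qint_int by (intro exI[of _ "\<lambda>_. -1"]) simp
  qed
  then obtain b where
    b: "qint (int n) dvd qpow (int r) - (\<Sum>i<n - 1. Poly_Mapping.single (int i) (b i))" by blast
  have "(\<Sum>i<n - 1. Poly_Mapping.single (int i) (c * b i + a i))
    = of_int c * (\<Sum>i<n - 1. Poly_Mapping.single (int i) (b i))
      + (\<Sum>i<n - 1. Poly_Mapping.single (int i) (a i))"
    by (simp only: single of_int_add of_int_mult sum.distrib sum_distrib_left distrib_right mult.assoc)
  then have "Poly_Mapping.single e c + f - (\<Sum>i<n - 1. Poly_Mapping.single (int i) (c * b i + a i))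
    = of_int c * (qpow e - qpow (e mod int n))
      + of_int c * (qpow (int r) - (\<Sum>i<n - 1. Poly_Mapping.single (int i) (b i)))
      + (f - (\<Sum>i<n - 1. Poly_Mapping.single (int i) (a i)))"
    unfolding r(2) single[of e c] by (simp only: right_diff_distrib) simp
  moreover have "qint (int n) dvd \<dots>"
    by (intro dvd_add dvd_mult qint_dvd_qpow_mod a b)
  ultimately show ?case by (intro exI[of _ "\<lambda>i. c * b i + a i"]) (simp only:)
qed

lemma ev_qint_mult: "z \<noteq> 0 \<Longrightarrow> (1 - z) * ev z (qint N) = 1 - z powi N"
  using arg_cong[OF qint_mult, of "ev z" N] by simp

text \<open>The remainder modulo \<open>[n]\<close> has only coefficients below index
  \<open>n - 1\<close>, yet it vanishes at the \<open>n - 1\<close> distinct \<open>n\<close>-th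
  roots of unity other than 1, so it is 0.\<close>

lemma qint_dvd_if_roots:
  assumes n: "n > 0" and ev: "\<And>z. z ^ n = 1 \<Longrightarrow> z \<noteq> 1 \<Longrightarrow> ev z f = 0"
  shows "qint (int n) dvd f"
proof -
  obtain a where a: "qint (int n) dvd f - (\<Sum>i<n - 1. Poly_Mapping.single (int i) (a i))"
    using qint_remainder[OF n] by blast
  define p :: "complex poly" where "p = (\<Sum>i<n - 1. monom (of_int (a i)) i)"
  have root: "poly p z = 0" if z: "z ^ n = 1" "z \<noteq> 1" for z
  proof -
    have z0: "z \<noteq> 0" using z n by (auto simp: power_0_left)
    have "(1 - z) * ev z (qint (int n)) = 0"
      using ev_qint_mult[OF z0, of "int n"] z by simp
    then have "ev z (qint (int n)) = 0" using z by simp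
    then have "ev z (f - (\<Sum>i<n - 1. Poly_Mapping.single (int i) (a i))) = 0"
      using a z0 by (auto simp del: ev_diff ev_sum elim!: dvdE)
    then have "ev z f - (\<Sum>i<n - 1. ev z (Poly_Mapping.single (int i) (a i))) = 0"
      by (simp only: ev_diff ev_sum)
    then show ?thesis
      using ev[OF z] by (simp add: p_def poly_sum poly_monom ev_single)
  qed
  have "p = 0"
  proof (rule ccontr)
    assume p: "p \<noteq> 0"
    have "n - 1 = card ({z::complex. z ^ n = 1} - {1})"
      using card_roots_unity_eq[OF n] by (simp add: card_Diff_singleton)
    also have "\<dots> \<le> card {z. poly p z = 0}"
      using root by (intro card_mono poly_roots_finite[OF p]) auto
    also have "\<dots> \<le> degree p" by (rule card_poly_roots_bound[OF p])
    finally have deg: "n - 1 \<le> degree p" .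
    \<comment> \<open>By construction \<open>p\<close> has no coefficient at or beyond index
      \<open>n - 1\<close>.\<close>
    then have "coeff p (degree p) = 0"
      by (simp add: p_def coeff_sum del: leading_coeff_0_iff)
    with p show False by simp
  qed
  have "a i = 0" if "i < n - 1" for i
  proof -
    have "coeff p i = of_int (a i)" using that by (simp add: p_def coeff_sum)
    with \<open>p = 0\<close> show ?thesis by simp
  qed
  with a show ?thesis by simp
qed

section \<open>Recurrences for q-binomial coefficients\<close>

lemma qbinom_mult_nat:
  "(\<Prod>i<k. qint (int i + 1)) * qbinom N (int k) = (\<Prod>i<k. qint (int N - int i))"
  using qbinom_mult[of "int k" N] by (simp add: prod_int_atLeastAtMost)

lemma qbinom_0_right [simp]: "qbinom N 0 = 1"
  using qbinom_mult[of 0 N] by simp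

lemma qfact_nonzero: "(\<Prod>i<k. qint (int i + 1)) \<noteq> 0"
  by (simp add: qint_nonzero)

lemma qbinom_Suc_right:
  "qint (int k + 1) * qbinom N (int k + 1) = qint (int N - int k) * qbinom N (int k)"
proof -
  have "(\<Prod>i<k. qint (int i + 1)) * (qint (int k + 1) * qbinom N (int k + 1))
      = (\<Prod>i<k. qint (int i + 1)) * (qint (int N - int k) * qbinom N (int k))"
    using qbinom_mult_nat[of k N] qbinom_mult_nat[of "Suc k" N]
    by (simp add: algebra_simps)
  then show ?thesis using qfact_nonzero by (metis mult_left_cancel)
qed

lemma qbinom_Suc_Suc:
  "qint (int k + 1) * qbinom (Suc N) (int k + 1) = qint (int N + 1) * qbinom N (int k)"
proof -
  have "(\<Prod>i<k. qint (int i + 1)) * (qint (int k + 1) * qbinom (Suc N) (int k + 1))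
      = (\<Prod>i<Suc k. qint (int (Suc N) - int i))"
    using qbinom_mult_nat[of "Suc k" "Suc N"] by (simp add: algebra_simps)
  also have "\<dots> = qint (int N + 1) * (\<Prod>i<k. qint (int N - int i))"
    by (subst prod.lessThan_Suc_shift) (simp add: add.commute)
  also have "\<dots> = (\<Prod>i<k. qint (int i + 1)) * (qint (int N + 1) * qbinom N (int k))"
    using qbinom_mult_nat[of k N] by (simp add: algebra_simps)
  finally show ?thesis using qfact_nonzero by (metis mult_left_cancel)
qed

text \<open>The splitting \<open>[N+1] = [k+1] + q^(k+1) [N-k]\<close> turns the two preceding
  recurrences into Pascal's rule once \<open>[k+1]\<close> is cancelled.\<close>

lemma qbinom_pascal:
  "qbinom (Suc N) (int k + 1) = qbinom N (int k) + qpow (int k + 1) * qbinom N (int k + 1)"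
proof -
  have "qint (int k + 1) * qbinom (Suc N) (int k + 1)
      = (qint (int k + 1) + qpow (int k + 1) * qint (int N - int k)) * qbinom N (int k)"
    unfolding qbinom_Suc_Suc using qint_add[of "int k + 1" "int N - int k"]
    by (simp add: add.commute)
  also have "\<dots> = qint (int k + 1) *
      (qbinom N (int k) + qpow (int k + 1) * qbinom N (int k + 1))"
    using qbinom_Suc_right[of k N] by (simp add: algebra_simps)
  finally show ?thesis
    using qint_nonzero[of "int k + 1"] by simp
qed

definition wcoeff :: "nat \<Rightarrow> nat \<Rightarrow> laurent"
  where "wcoeff k j = qbinom (k - 1) (int j - 1) * qbinom (k + j) (int j)
         - qbinom k (int j) * qbinom (k + j) (int j - 1)"

text \<open>With \<open>[k][k-1,j-1] = [j][k,j]\<close> and \<open>[k+1][k+j,j-1] = [j][k+j,j]\<close> the two products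
  combine, because \<open>[k+1] - [k] = q\<^sup>k\<close>.\<close>

lemma wcoeff_closed_form:
  assumes "k > 0" "j > 0"
  shows "qint (int k) * qint (int k + 1) * wcoeff k j
    = qpow (int k) * qint (int j) * qbinom k (int j) * qbinom (k + j) (int j)"
proof -
  obtain l i where [simp]: "k = Suc l" "j = Suc i" using assms by (metis gr0_implies_Suc)
  have 1: "qint (int k) * qbinom (k - 1) (int j - 1) = qint (int j) * qbinom k (int j)"
    using qbinom_Suc_Suc[of i l] by (simp add: add.commute)
  have 2: "qint (int k + 1) * qbinom (k + j) (int j - 1) = qint (int j) * qbinom (k + j) (int j)"
    using qbinom_Suc_right[of i "k + j"] by (simp add: add.commute)
  have 3: "qint (int k + 1) - qint (int k) = qpow (int k)"
    using qint_add[of "int k" 1] qint_mult[of 1] one_minus_qpow_nonzero[of 1] by simp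
  have "qint (int k) * qint (int k + 1) * wcoeff k j
    = qint (int k + 1) * (qint (int k) * qbinom (k - 1) (int j - 1)) * qbinom (k + j) (int j)
     - qint (int k) * qbinom k (int j) * (qint (int k + 1) * qbinom (k + j) (int j - 1))"
    unfolding wcoeff_def by (simp only: algebra_simps)
  also have "\<dots> = (qint (int k + 1) - qint (int k)) * qint (int j) * qbinom k (int j)
      * qbinom (k + j) (int j)"
    unfolding 1 2 by (simp only: algebra_simps)
  finally show ?thesis unfolding 3 .
qed

text \<open>Fails for \<open>k = 0\<close>, where the truncated \<open>k - 1\<close> gives \<open>wcoeff 0 1 = 1\<close> although \<open>w \<alpha> 0 = 0\<close>.\<close>

lemma coeff_w:
  assumes "\<alpha> > 0" "k > 0"
  shows "coeff (w \<alpha> k) i =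
    (qpow (int (Suc (Suc i) choose 2) - (int k + 1) * int i) * wcoeff k (Suc i)) ^ \<alpha>"
proof -
  have pow: "qpow (int \<alpha> * e) = qpow e ^ \<alpha>" for e
    by (induction \<alpha>) (simp_all add: qpow_add algebra_simps)
  have "coeff (w \<alpha> k) i = (\<Sum>j=1..k. if j = Suc i then
      (qpow (int (Suc (Suc i) choose 2) - (int k + 1) * int i) * wcoeff k (Suc i)) ^ \<alpha> else 0)"
    unfolding w_def coeff_sum
    by (intro sum.cong refl) (auto simp: pow power_mult_distrib wcoeff_def)
  \<comment> \<open>For \<open>i \<ge> k\<close> no index \<open>j\<close> matches; there both
    products in \<open>wcoeff k (Suc i)\<close> vanish, and so does the power, as
    \<open>\<alpha> > 0\<close>.\<close>
  also have "\<dots> = (qpow (int (Suc (Suc i) choose 2) - (int k + 1) * int i) * wcoeff k (Suc i)) ^ \<alpha>"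
    using assms by (auto simp: sum.delta wcoeff_def qbinom_def power_0_left)
  finally show ?thesis .
qed

lemma qbinom_neg [simp]: "k < 0 \<Longrightarrow> qbinom N k = 0"
  by (simp add: qbinom_def)

lemma qbinom_gt [simp]: "k > int N \<Longrightarrow> qbinom N k = 0"
  by (simp add: qbinom_def)

text \<open>Covering all integers \<open>k\<close> lets the recurrence be used at the shifted index
  \<open>k - d\<close>, which may be negative.\<close>

lemma qbinom_pascal_int: "qbinom (Suc N) k = qbinom N (k - 1) + qpow k * qbinom N k"
proof -
  consider "k < 0" | "k = 0" | "k > 0" by linarith
  then show ?thesis
  proof cases
    case 3
    then show ?thesis using qbinom_pascal[of N "nat (k - 1)"] by simp
  qed simp_all
qed

lemma qbinom_self [simp]: "qbinom N (int N) = 1"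
proof (induction N)
  case (Suc N)
  then show ?case
    using qbinom_Suc_Suc[of N N] qint_nonzero[of "int N + 1"] by (simp add: add.commute)
qed simp

lemma smult_sum_right: "smult c (sum f A) = (\<Sum>a\<in>A. smult c (f a))"
  by (induction A rule: infinite_finite_induct) (simp_all add: smult_add_right)

section \<open>Values at a root of unity\<close>

text \<open>A primitive \<open>d\<close>-th root of unity; \<open>d > 1\<close> excludes
  \<open>z = 1\<close>, where \<open>[N]\<close> is not given by
  \<open>(1 - z^N)/(1 - z)\<close>.\<close>

locale root_of_unity =
  fixes z :: complex and d :: nat
  assumes order_gt_1: "d > 1" and root: "z ^ d = 1"
    and minimal: "\<And>i. 0 < i \<Longrightarrow> i < d \<Longrightarrow> z ^ i \<noteq> 1"
begin

lemma nonzero [simp]: "z \<noteq> 0"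
  using root order_gt_1 by (auto simp: power_0_left)

lemma not_1 [simp]: "z \<noteq> 1"
  using minimal[of 1] order_gt_1 by simp

lemma powi_period: "z powi (e + int d * k) = z powi e"
  by (simp add: power_int_add power_int_mult root)

section \<open>q-integers at a root of unity\<close>

definition Q :: "int \<Rightarrow> complex"
  where "Q N = ev z (qint N)"

lemma Q_eq: "Q N = (1 - z powi N) / (1 - z)"
  using ev_qint_mult[of z N] by (simp add: Q_def field_simps)

lemma Q_period: "Q (N + int d * k) = Q N"
  by (simp add: Q_eq powi_period)

lemma Q_0 [simp]: "Q 0 = 0"
  by (simp add: Q_eq)

lemma Q_multiple: "int d dvd N \<Longrightarrow> Q N = 0"
  using Q_period[of 0] by (auto elim!: dvdE)

lemma Q_minus: "Q (- N) = - (z powi (- N) * Q N)"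
  by (simp add: Q_eq power_int_minus field_simps)

lemma Q_nonzero: "0 < N \<Longrightarrow> N < int d \<Longrightarrow> Q N \<noteq> 0"
  using minimal[of "nat N"] by (simp add: Q_eq power_int_def)

section \<open>q-binomial coefficients at a root of unity and the q-Lucas theorem\<close>

definition B :: "nat \<Rightarrow> int \<Rightarrow> complex"
  where "B N k = ev z (qbinom N k)"

lemma B_simps [simp]: "k < 0 \<Longrightarrow> B N k = 0" "k > int N \<Longrightarrow> B N k = 0"
    "B N 0 = 1" "B N (int N) = 1"
  by (simp_all add: B_def)

lemma B_pascal: "B (Suc N) k = B N (k - 1) + z powi k * B N k"
  by (simp add: B_def qbinom_pascal_int)

lemma B_mult: "(\<Prod>i<k. Q (int i + 1)) * B N (int k) = (\<Prod>i<k. Q (int N - int i))"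
  using arg_cong[OF qbinom_mult_nat, of "ev z" k N] by (simp add: B_def Q_def)

lemma fact_nonzero: "k < d \<Longrightarrow> (\<Prod>i<k. Q (int i + 1)) \<noteq> 0"
  by (simp add: Q_nonzero)

text \<open>For \<open>0 < k < d\<close> the numerator contains \<open>[d]\<close>, which vanishes
  at \<open>z\<close>, while the denominator \<open>[1]...[k]\<close> does not.\<close>

lemma B_order: "B d k = (if k = 0 \<or> k = int d then 1 else 0)"
proof -
  consider "k < 0" | "k = 0" | "0 < k" "k < int d" | "k = int d" | "k > int d" by linarith
  then show ?thesis
  proof cases
    case 3
    have "(\<Prod>i<nat k. Q (int i + 1)) * B d k = (\<Prod>i<nat k. Q (int d - int i))"
      using 3 B_mult[of "nat k" d] by simp
    also have "\<dots> = 0"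
      using 3 by (auto intro!: bexI[of _ 0] Q_multiple)
    finally show ?thesis using 3 fact_nonzero[of "nat k"] by auto
  qed auto
qed

text \<open>Both sides obey the same Pascal recurrence in \<open>N\<close>, because
  \<open>z^(k-d) = z^k\<close>; the row \<open>N = 0\<close> is \<open>B_order\<close>.\<close>

lemma B_add_order: "B (N + d) k = B N k + B N (k - int d)"
proof (induction N arbitrary: k)
  case 0
  have "B 0 k = (if k = 0 then 1 else 0)" for k
    by (cases k "0::int" rule: linorder_cases) simp_all
  then show ?case using order_gt_1 by (simp add: B_order)
next
  case (Suc N)
  have "z powi (k - int d) = z powi k"
    using powi_period[of k "-1"] by simp
  then show ?case
    using Suc[of k] Suc[of "k - 1"] B_pascal[of "N + d" k] B_pascal[of N k]
      B_pascal[of N "k - int d"]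
    by (simp add: algebra_simps)
qed

text \<open>By \<open>B_add_order\<close>, raising \<open>a\<close> by 1 acts as the ordinary Pascal
  rule on \<open>a choose s\<close> and leaves \<open>B b t\<close> untouched.\<close>

lemma q_Lucas:
  assumes "b < d" "t < d"
  shows "B (a * d + b) (int (s * d + t)) = of_nat (a choose s) * B b (int t)"
proof (induction a arbitrary: s)
  case 0
  show ?case
  proof (cases s)
    case (Suc s')
    then have "int b < int (s * d + t)"
      using assms by (metis add.commute add_lessD1 mult_Suc of_nat_less_iff trans_less_add1)
    then show ?thesis using Suc by (simp only: B_simps) simp
  qed simp
next
  case (Suc a)
  have *: "B (Suc a * d + b) k = B (a * d + b) k + B (a * d + b) (k - int d)" for k
    using B_add_order[of "a * d + b" k] by (simp add: algebra_simps)
  show ?case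
  proof (cases s)
    case 0
    \<comment> \<open>The second summand has the negative lower index \<open>t - d\<close>.\<close>
    then show ?thesis using Suc[of 0] assms unfolding * by simp
  next
    case (Suc s')
    have "int (s * d + t) - int d = int (s' * d + t)" by (simp add: Suc)
    then have "B (Suc a * d + b) (int (s * d + t))
        = of_nat (a choose s) * B b (int t) + of_nat (a choose s') * B b (int t)"
      unfolding * by (simp only: Suc.IH)
    then show ?thesis by (simp add: Suc distrib_right)
  qed
qed

section \<open>Reflection of the products of two q-binomial coefficients\<close>

definition F :: "nat \<Rightarrow> nat \<Rightarrow> complex"
  where "F k j = B k (int j) * B (k + j) (int j)"

text \<open>The factors are paired so that the reflection of \<open>b\<close> to
  \<open>d - 1 - b\<close> can be carried out factor by factor.\<close>

lemma F_mult:
  "(\<Prod>i<t. Q (int i + 1)) ^ 2 * F b t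
    = (\<Prod>i<t. Q (int b - int i) * Q (int b + int i + 1))"
proof -
  have "(\<Prod>i<t. Q (int (b + t) - int i)) = (\<Prod>i<t. Q (int b + int i + 1))"
    by (subst prod.nat_diff_reindex[symmetric])
      (intro prod.cong arg_cong[of _ _ Q], auto simp: of_nat_diff)
  then show ?thesis
    using B_mult[of t b] B_mult[of t "b + t"]
    by (simp add: F_def prod.distrib power2_eq_square algebra_simps)
qed

text \<open>Modulo \<open>d\<close> the reflection sends \<open>b - i\<close> to
  \<open>-(b+i+1)\<close> and \<open>b + i + 1\<close> to \<open>-(b-i)\<close>. The two signs
  cancel, and each of the \<open>t\<close> factor pairs contributes
  \<open>z^(-(2b+1))\<close>.\<close>

lemma F_reflect_residue:
  assumes "b < d" "t < d"
  shows "F (d - 1 - b) t = z powi (- ((2 * int b + 1) * int t)) * F b t"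
proof -
  have factor: "Q (int (d - 1 - b) - int i) * Q (int (d - 1 - b) + int i + 1)
      = z powi (- (2 * int b + 1)) * (Q (int b - int i) * Q (int b + int i + 1))" for i
  proof -
    have "Q (int (d - 1 - b) - int i) = Q (- (int b + int i + 1))"
      using Q_period[of "- (int b + int i + 1)" 1] assms by (simp add: of_nat_diff algebra_simps)
    moreover have "Q (int (d - 1 - b) + int i + 1) = Q (- (int b - int i))"
      using Q_period[of "- (int b - int i)" 1] assms by (simp add: of_nat_diff algebra_simps)
    moreover have "z powi (- (2 * int b + 1))
        = z powi (- (int b + int i + 1)) * z powi (- (int b - int i))"
      by (subst power_int_add[symmetric]) simp_all
    ultimately show ?thesis unfolding Q_minus by simp
  qed
  have "(\<Prod>i<t. Q (int i + 1)) ^ 2 * F (d - 1 - b) t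
      = (z powi (- (2 * int b + 1))) ^ t * ((\<Prod>i<t. Q (int i + 1)) ^ 2 * F b t)"
    unfolding F_mult factor by (simp add: prod.distrib)
  also have "(z powi (- (2 * int b + 1))) ^ t = z powi (- ((2 * int b + 1) * int t))"
    by (simp only: power_int_power' minus_mult_left)
  finally show ?thesis
    using fact_nonzero[OF assms(2)] by simp
qed

text \<open>If \<open>b + t\<close> carries past \<open>d\<close>, Lucas gives \<open>[b+t-d,t] = 0\<close>, and the right-hand side vanishes
  because the numerator of \<open>[b+t,t]\<close> contains \<open>[d]\<close>.\<close>

lemma F_Lucas:
  assumes "b < d" "t < d"
  shows "F (a * d + b) (s * d + t) = of_nat (a choose s) * of_nat (a + s choose s) * F b t"
proof (cases "b + t < d")
  case True
  have *: "a * d + b + (s * d + t) = (a + s) * d + (b + t)" by (simp add: algebra_simps)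
  show ?thesis
    unfolding F_def * q_Lucas[OF assms] q_Lucas[OF True assms(2)] by simp
next
  case False
  then obtain u where u: "b + t = d + u" by (metis leI le_iff_add)
  have "u < t" "u < d" using u assms by auto
  have "a * d + b + (s * d + t) = Suc (a + s) * d + u" using u by (simp add: algebra_simps)
  then have "B (a * d + b + (s * d + t)) (int (s * d + t)) = 0"
    using q_Lucas[OF \<open>u < d\<close> assms(2), of "Suc (a + s)" s] \<open>u < t\<close> by simp
  moreover have "B (b + t) (int t) = 0"
  proof -
    have "(\<Prod>i<t. Q (int (b + t) - int i)) = 0"
      using \<open>u < t\<close> u by (auto intro!: bexI[of _ u] Q_multiple)
    then have "(\<Prod>i<t. Q (int i + 1)) * B (b + t) (int t) = 0" by (simp only: B_mult)
    then show ?thesis using fact_nonzero[OF assms(2)] by (simp only: mult_eq_0_iff) blast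
  qed
  ultimately show ?thesis by (simp add: F_def)
qed

text \<open>The binomial factors in \<open>F_Lucas\<close> depend only on \<open>a\<close> and
  \<open>j div d\<close>, so they agree on both sides; the power of \<open>z\<close> sees
  \<open>j\<close> only modulo \<open>d\<close>.\<close>

lemma F_reflect:
  assumes "b < d"
  shows "F (a * d + (d - 1 - b)) j = z powi (- ((2 * int b + 1) * int j)) * F (a * d + b) j"
proof -
  define s t where "s = j div d" "t = j mod d"
  have j: "j = s * d + t" and t: "t < d" using order_gt_1 by (simp_all add: s_t_def)
  have "z powi (- ((2 * int b + 1) * int j)) = z powi (- ((2 * int b + 1) * int t))"
    using powi_period[of "- ((2 * int b + 1) * int t)" "- ((2 * int b + 1) * int s)"]
    by (simp add: j algebra_simps)
  then show ?thesis
    using assms t F_Lucas[of b t a s] F_Lucas[of "d - 1 - b" t a s] F_reflect_residue[of b t]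
    by (simp add: j)
qed

section \<open>Reflection of the coefficients of \<open>w\<close>\<close>

text \<open>For \<open>k > 0\<close> this is the coefficient of \<open>x^i\<close> in
  \<open>w 1 k\<close> at \<open>q = z\<close>, scaled by \<open>z^(-k)\<close>; its
  \<open>\<alpha>\<close>-th power serves general \<open>\<alpha>\<close>. The scaling cancels the
  \<open>q^k\<close> of \<open>wcoeff_closed_form\<close>.\<close>

definition V :: "nat \<Rightarrow> nat \<Rightarrow> complex"
  where "V k i = z powi (- int k) *
    (z powi (int (Suc (Suc i) choose 2) - (int k + 1) * int i) * ev z (wcoeff k (Suc i)))"

lemma V_closed_form:
  assumes "k > 0"
  shows "Q (int k) * Q (int k + 1) * V k i
    = z powi (int (Suc (Suc i) choose 2) - (int k + 1) * int i) * Q (int (Suc i)) * F k (Suc i)"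
proof -
  let ?E = "z powi (int (Suc (Suc i) choose 2) - (int k + 1) * int i)"
  have w: "Q (int k) * Q (int k + 1) * ev z (wcoeff k (Suc i))
      = z powi int k * Q (int (Suc i)) * F k (Suc i)"
    using arg_cong[OF wcoeff_closed_form[OF assms, of "Suc i"], of "ev z"]
    by (simp add: Q_def F_def B_def mult.assoc)
  have "Q (int k) * Q (int k + 1) * V k i
    = z powi (- int k) * ?E * (Q (int k) * Q (int k + 1) * ev z (wcoeff k (Suc i)))"
    unfolding V_def by (simp only: mult_ac)
  also have "\<dots> = (z powi (- int k) * z powi int k) * (?E * Q (int (Suc i)) * F k (Suc i))"
    unfolding w by (simp only: mult_ac)
  also have "z powi (- int k) * z powi int k = 1"
    by (subst power_int_add[symmetric]) simp_all
  finally show ?thesis by simp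
qed

text \<open>Under reflection both sides of \<open>V_closed_form\<close> acquire the factor
  \<open>z^(-(2b+1))\<close>. The bounds on \<open>b\<close> keep \<open>[b]\<close> and
  \<open>[b+1]\<close> nonzero at \<open>z\<close>, so that they can be cancelled.\<close>

lemma V_reflect:
  assumes b: "0 < b" "b < d - 1"
  shows "V (a * d + (d - 1 - b)) i = V (a * d + b) i"
proof -
  define k k' where "k = a * d + b" and "k' = a * d + (d - 1 - b)"
  have ik: "int k = int b + int d * int a" by (simp add: k_def)
  have ik': "int k' = - 1 - int b + int d * (int a + 1)"
    using b by (simp add: k'_def of_nat_diff algebra_simps)
  let ?E = "int (Suc (Suc i) choose 2)"
  have Qk: "Q (int k) = Q (int b)" "Q (int k + 1) = Q (int b + 1)"
    using Q_period[of "int b" "int a"] Q_period[of "int b + 1" "int a"]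
    by (simp_all add: ik add_ac)
  have "Q (int k') = Q (- (int b + 1))" "Q (int k' + 1) = Q (- int b)"
    using Q_period[of "- (int b + 1)" "int a + 1"] Q_period[of "- int b" "int a + 1"]
    by (simp_all add: ik' algebra_simps)
  moreover have "z powi (- (2 * int b + 1)) = z powi (- (int b + 1)) * z powi (- int b)"
    by (subst power_int_add[symmetric]) simp_all
  ultimately have Qk': "Q (int k') * Q (int k' + 1)
      = z powi (- (2 * int b + 1)) * (Q (int k) * Q (int k + 1))"
    unfolding Q_minus Qk by simp
  have "z powi (?E - (int k' + 1) * int i) * z powi (- ((2 * int b + 1) * int (Suc i)))
      = z powi (?E - (int k' + 1) * int i + (- ((2 * int b + 1) * int (Suc i))))"
    by (simp only: power_int_add[OF disjI1[OF nonzero]])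
  \<comment> \<open>Substituting \<open>k = ad + b\<close> and \<open>k' + 1 = (a+1)d - b\<close>
    leaves the extra term \<open>-di\<close>, which \<open>powi_period\<close> discards.\<close>
  also have "?E - (int k' + 1) * int i + (- ((2 * int b + 1) * int (Suc i)))
      = - (2 * int b + 1) + (?E - (int k + 1) * int i) + int d * (- int i)"
    unfolding ik ik' by (simp add: algebra_simps)
  also have "z powi \<dots> = z powi (- (2 * int b + 1)) * z powi (?E - (int k + 1) * int i)"
    unfolding powi_period by (simp only: power_int_add[OF disjI1[OF nonzero]])
  finally have E: "z powi (?E - (int k' + 1) * int i) * z powi (- ((2 * int b + 1) * int (Suc i)))
      = z powi (- (2 * int b + 1)) * z powi (?E - (int k + 1) * int i)" .
  have "k > 0" "k' > 0" using b by (simp_all add: k_def k'_def)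
  have "z powi (- (2 * int b + 1)) * (Q (int k) * Q (int k + 1)) * V k' i
      = z powi (?E - (int k' + 1) * int i) * Q (int (Suc i)) * F k' (Suc i)"
    unfolding V_closed_form[OF \<open>k' > 0\<close>, symmetric] Qk' ..
  also have "\<dots> = (z powi (?E - (int k' + 1) * int i) * z powi (- ((2 * int b + 1) * int (Suc i))))
      * Q (int (Suc i)) * F k (Suc i)"
    using F_reflect[of b a "Suc i"] b unfolding k_def[symmetric] k'_def[symmetric]
    by (simp only: mult_ac)
  also have "\<dots> = z powi (- (2 * int b + 1)) * (Q (int k) * Q (int k + 1)) * V k i"
    unfolding E mult.assoc[of "z powi (- (2 * int b + 1))"] V_closed_form[OF \<open>k > 0\<close>]
    by (simp only: mult_ac)
  finally have "z powi (- (2 * int b + 1)) * (Q (int k) * Q (int k + 1)) * V k' i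
      = z powi (- (2 * int b + 1)) * (Q (int k) * Q (int k + 1)) * V k i" .
  moreover have "z powi (- (2 * int b + 1)) * (Q (int k) * Q (int k + 1)) \<noteq> 0"
    unfolding Qk using b Q_nonzero[of "int b"] Q_nonzero[of "int b + 1"] by simp
  ultimately show ?thesis unfolding k_def k'_def by (metis mult_left_cancel)
qed

section \<open>Cancellation within blocks of length \<open>d\<close>\<close>

definition W :: "nat \<Rightarrow> nat \<Rightarrow> complex poly"
  where "W \<alpha> k = smult (z powi (- (int \<alpha> * int k))) (evp z (w \<alpha> k))"

lemma W_reflect:
  assumes "\<alpha> > 0" "0 < b" "b < d - 1"
  shows "W \<alpha> (a * d + (d - 1 - b)) = W \<alpha> (a * d + b)"
proof -
  have "coeff (W \<alpha> k) i = V k i ^ \<alpha>" if "k > 0" for k i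
    using that assms(1)
    by (simp add: W_def V_def coeff_w power_mult_distrib power_int_power' mult.commute)
  then show ?thesis
    using assms V_reflect[OF assms(2,3)] by (simp add: poly_eq_iff)
qed

text \<open>The term of the theorem at \<open>q = z\<close> without the constant
  \<open>z^((n-1)(\<alpha>m+1))\<close>. Of the remaining weight \<open>z^(-k(\<alpha>m+1))\<close>,
  \<open>W \<alpha> k ^ m\<close> carries \<open>z^(-\<alpha>mk)\<close>, and \<open>z^(-k)\<close>
  stays with \<open>[2k+1]\<close>.\<close>

definition summand :: "nat \<Rightarrow> nat \<Rightarrow> nat \<Rightarrow> nat \<Rightarrow> complex poly"
  where "summand \<alpha> m r k =
    smult (Q (int (k * (k + 1))) ^ r * (z powi (- int k) * Q (2 * int k + 1))) (W \<alpha> k ^ m)"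

lemma summand_reflect:
  assumes "\<alpha> > 0" "r > 0" "b < d"
  shows "summand \<alpha> m r (a * d + (d - 1 - b)) = - summand \<alpha> m r (a * d + b)"
proof -
  define k k' where "k = a * d + b" and "k' = a * d + (d - 1 - b)"
  have ik: "int k' = int d * (2 * int a + 1) - 1 - int k"
    using assms by (simp add: k_def k'_def of_nat_diff algebra_simps)
  \<comment> \<open>The multiple of \<open>d\<close> comes from
    \<open>k'(k'+1) - k(k+1) = (k'+k+1)(k'-k)\<close> with
    \<open>k' + k + 1 = (2a+1)d\<close>.\<close>
  have Qkk: "Q (int (k' * (k' + 1))) = Q (int (k * (k + 1)))"
    using Q_period[of "int (k * (k + 1))"
        "(2 * int a + 1) * (int d * (2 * int a + 1) - 1 - 2 * int k)"]
    by (simp add: ik algebra_simps)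
  show ?thesis
  proof (cases "b = 0 \<or> b = d - 1")
    case True
    then have "d dvd k \<or> d dvd k + 1"
      using order_gt_1 by (auto simp: k_def)
    then have "d dvd k * (k + 1)" by (metis dvd_mult dvd_mult2)
    then have "int d dvd int (k * (k + 1))" by (simp only: int_dvd_int_iff)
    then have "Q (int (k * (k + 1))) = 0" by (rule Q_multiple)
    then show ?thesis
      unfolding k_def[symmetric] k'_def[symmetric] summand_def Qkk
      using \<open>r > 0\<close> by (simp add: power_0_left)
  next
    case False
    then have "0 < b" "b < d - 1" using assms by auto
    then have W: "W \<alpha> k' = W \<alpha> k"
      using W_reflect[OF assms(1)] by (simp add: k_def k'_def)
    have "Q (2 * int k' + 1) = Q (- (2 * int k + 1))"
      using Q_period[of "- (2 * int k + 1)" "2 * (2 * int a + 1)"]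
      by (simp add: ik algebra_simps)
    moreover have "z powi (- int k') = z powi (int k + 1)"
      using powi_period[of "int k + 1" "- (2 * int a + 1)"] by (simp add: ik algebra_simps)
    \<comment> \<open>The power of \<open>z\<close> produced by \<open>Q_minus\<close> is exactly
      what turns \<open>z^(-k')\<close> back into \<open>z^(-k)\<close>.\<close>
    moreover have "z powi (int k + 1) * z powi (- (2 * int k + 1)) = z powi (- int k)"
      by (subst power_int_add[symmetric]) simp_all
    ultimately have "z powi (- int k') * Q (2 * int k' + 1) = - (z powi (- int k) * Q (2 * int k + 1))"
      unfolding Q_minus by (metis mult.assoc mult_minus_right)
    then show ?thesis
      unfolding k_def[symmetric] k'_def[symmetric] summand_def Qkk W by simp
  qed
qed

text \<open>Reversing a block shows that its sum equals its own negative, hence is 0; this also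
  covers the middle term \<open>b = d - 1 - b\<close> for odd \<open>d\<close>.\<close>

lemma sum_summand:
  assumes "\<alpha> > 0" "r > 0"
  shows "(\<Sum>k<l * d. summand \<alpha> m r k) = 0"
proof -
  have "(\<Sum>k\<in>{a * d..<a * d + d}. summand \<alpha> m r k) = 0" for a
  proof -
    let ?S = "\<Sum>b<d. summand \<alpha> m r (a * d + b)"
    have "?S = (\<Sum>b<d. summand \<alpha> m r (a * d + (d - 1 - b)))"
      by (subst sum.nat_diff_reindex[symmetric]) simp
    also have "\<dots> = - ?S"
      using summand_reflect[OF assms] by (simp add: sum_negf)
    finally have "?S = - ?S" .
    then have "?S = 0" by (simp add: poly_eq_iff)
    then show ?thesis
      using sum.shift_bounds_nat_ivl[of "summand \<alpha> m r" 0 "a * d" d]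
      by (simp add: atLeast0LessThan add.commute)
  qed
  then show ?thesis
    by (subst sum.nat_group[symmetric]) simp
qed

lemma evp_term:
  "evp z ([:qint (int (k * (k + 1))) ^ r * qint (2 * int k + 1)
         * qpow ((int n - 1 - int k) * (int \<alpha> * int m + 1)):] * w \<alpha> k ^ m)
   = smult (z powi ((int n - 1) * (int \<alpha> * int m + 1))) (summand \<alpha> m r k)"
proof -
  have evp_w: "evp z (w \<alpha> k) = smult (z powi (int \<alpha> * int k)) (W \<alpha> k)"
    unfolding W_def by (simp add: power_int_minus)
  have powi: "z powi ((int n - 1 - int k) * (int \<alpha> * int m + 1)) * (z powi (int \<alpha> * int k)) ^ m
      = z powi ((int n - 1) * (int \<alpha> * int m + 1)) * z powi (- int k)"
    unfolding power_int_power' by (subst (1 2) power_int_add[symmetric]) (simp_all add: algebra_simps)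
  have "evp z ([:qint (int (k * (k + 1))) ^ r * qint (2 * int k + 1)
         * qpow ((int n - 1 - int k) * (int \<alpha> * int m + 1)):] * w \<alpha> k ^ m)
      = [:Q (int (k * (k + 1))) ^ r * Q (2 * int k + 1)
          * z powi ((int n - 1 - int k) * (int \<alpha> * int m + 1)):] * evp z (w \<alpha> k) ^ m"
    unfolding Q_def by (simp only: evp_mult evp_power evp_const ev_mult ev_power ev_qpow nonzero
        not_False_eq_True)
  also have "\<dots> = smult (Q (int (k * (k + 1))) ^ r * Q (2 * int k + 1)
      * (z powi ((int n - 1 - int k) * (int \<alpha> * int m + 1)) * (z powi (int \<alpha> * int k)) ^ m))
      (W \<alpha> k ^ m)"
    unfolding evp_w smult_power by (simp add: mult_ac del: of_nat_mult)
  also have "\<dots> = smult (z powi ((int n - 1) * (int \<alpha> * int m + 1))) (summand \<alpha> m r k)"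
    unfolding powi summand_def smult_smult by (simp only: mult_ac)
  finally show ?thesis .
qed

end

section \<open>From all roots of unity to the congruence\<close>

lemma order_of_root_of_unity:
  assumes "n > 0" "z ^ n = (1 :: complex)" "z \<noteq> 1"
  obtains d where "root_of_unity z d" "d dvd n"
proof -
  define d where "d = (LEAST i. 0 < i \<and> z ^ i = 1)"
  have d: "0 < d" "z ^ d = 1"
    using LeastI[of "\<lambda>i. 0 < i \<and> z ^ i = 1" n] assms by (auto simp: d_def)
  have minimal: "z ^ i \<noteq> 1" if "0 < i" "i < d" for i
    using not_less_Least[of i "\<lambda>i. 0 < i \<and> z ^ i = 1"] that by (auto simp: d_def)
  have "d \<noteq> 1" using d assms by auto
  then have "root_of_unity z d"
    using d minimal by unfold_locales auto
  moreover have "z ^ (n mod d) = 1"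
  proof -
    have "z ^ n = z ^ (d * (n div d) + n mod d)" by simp
    also have "\<dots> = z ^ (n mod d)" by (simp only: power_add power_mult d) simp
    finally show ?thesis using assms by simp
  qed
  then have "d dvd n"
    using minimal[of "n mod d"] d by (auto simp: dvd_eq_mod_eq_0)
  ultimately show ?thesis by (rule that)
qed

theorem theorem1:
  fixes \<alpha> m n r :: nat
  assumes "\<alpha> > 0" "m > 0" "n > 0" "r > 0"
  shows "[:qint (int n):] dvd
    (\<Sum>k=0..n - 1.
       [:qint (int (k * (k + 1))) ^ r * qint (2 * int k + 1)
         * qpow ((int n - 1 - int k) * (int \<alpha> * int m + 1)):] * w \<alpha> k ^ m)"
    (is "_ dvd ?S")
proof -
  have zero: "evp z ?S = 0" if z: "z ^ n = 1" "z \<noteq> 1" for z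
  proof -
    obtain d l where "root_of_unity z d" and n: "n = l * d"
      using order_of_root_of_unity[OF \<open>n > 0\<close> z] by (metis dvdE mult.commute)
    then interpret root_of_unity z d by simp
    have "{0..n - 1} = {..<n}" using \<open>n > 0\<close> by auto
    then have "evp z ?S = smult (z powi ((int n - 1) * (int \<alpha> * int m + 1)))
        (\<Sum>k<n. summand \<alpha> m r k)"
      unfolding evp_sum evp_term by (simp only: smult_sum_right)
    also have "\<dots> = 0"
      unfolding n using sum_summand assms by simp
    finally show ?thesis .
  qed
  \<comment> \<open>Divisibility by a constant polynomial is tested coefficientwise, so the root
    criterion applies to each Laurent coefficient separately.\<close>
  have "ev z (coeff ?S i) = 0" if "z ^ n = 1" "z \<noteq> 1" for z i
    using zero[OF that] by (simp only: coeff_evp[symmetric] coeff_0)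
  then have "qint (int n) dvd coeff ?S i" for i
    by (intro qint_dvd_if_roots \<open>n > 0\<close>)
  then show ?thesis by (simp only: const_poly_dvd_iff simp_thms)
qed

end
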